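(* Let $R$ be a commutative Krasner $(m,n)$-hyperring with scalar identity $1_R$ and let $Q$ be a proper hyperideal of $R$. Then $Q$ is an $n$-ary $J$-hyperideal of $R$ if and only if for every $x\in R$ with $x\notin Q$ one has $U_x\subseteq J_{(m,n)}(R)$, where $U_x=\{y\in R\mid g(x,y,1_R^{(n-2)})\in Q\}$.
   Context: Notation: $m,n\ge 2$; $x_i^j$ denotes the sequence $x_i,\dots,x_j$ (empty if $j<i$), and $x^{(k)}$ denotes $x$ repeated $k$ times. An $m$-ary hyperoperation on $R$ is a map $f:R^m\to P^*(R)$ (nonempty subsets of $R$); operations and hyperoperations are extended to subsets by taking unions over elements (an element in an argument slot is identified with its singleton). Krasner $(m,n)$-hyperring $(R,f,g)$: (1) $(R,f)$ is a canonical $m$-ary hypergroup: $f$ is associative ($f(x_1^{i-1},f(x_i^{m+i-1}),x_{m+i}^{2m-1})$ is independent of $i$), every equation $b\in f(a_1^{i-1},x_i,a_{i+1}^m)$ is solvable in $x_i$, there is a unique $0\in R$ with $f(x,0^{(m-1)})=x$ for all $x$, each $x$ has a unique inverse $x^{-1}$ with $0\in f(x,x^{-1},0^{(m-2)})$, and $x\in f(x_1^m)$ implies $x_i\in f(x,x_1^{-1},\dots,x_{i-1}^{-1},x_{i+1}^{-1},\dots,x_m^{-1})$ for all $i$; (2) $g:R^n\to R$ is an associative $n$-ary operation; (3) $g$ distributes over $f$ in each argument: $g(a_1^{i-1},f(x_1^m),a_{i+1}^n)=f(g(a_1^{i-1},x_1,a_{i+1}^n),\dots,g(a_1^{i-1},x_m,a_{i+1}^n))$;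 (4) $g(x_1^n)=0$ whenever some $x_i=0$. Commutative: $f$ and $g$ are invariant under permutations of their arguments. Scalar identity: $1_R\in R$ with $g(x,1_R^{(n-1)})=x$ for all $x$. A hyperideal is a nonempty $I\subseteq R$ such that $(I,f)$ is an $m$-ary subhypergroup ($f(x_1^m)\subseteq I$ for $x_1^m\in I$, and $b\in f(b_1^{i-1},x_i,b_{i+1}^m)$ has a solution $x_i\in I$ for all $b,b_j\in I$) and $g(x_1^{i-1},I,x_{i+1}^n)\subseteq I$ for all $x_j\in R$ and all $i$. It is proper if $I\ne R$. A proper hyperideal $M$ is maximal if $M\subseteq N\subseteq R$ with $N$ a hyperideal implies $N=M$ or $N=R$. $J_{(m,n)}(R)$ is the intersection of all maximal hyperideals of $R$ (and is $R$ if there are none). A proper hyperideal $Q$ is an $n$-ary $J$-hyperideal if for all $x_1^n\in R$ and all $1\le i\le n$: $g(x_1^n)\in Q$ and $x_i\notin J_{(m,n)}(R)$ imply $g(x_1^{i-1},1_R,x_{i+1}^n)\in Q$. *)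

theory Defs
  imports Main "HOL-Library.Multiset" "HOL-Library.NList"
begin

text \<open>
  A \<open>k\<close>-ary (hyper)operation on a carrier \<open>R\<close> is a function on lists; only its values on
  \<open>nlists k R\<close>, the lists of length \<open>k\<close> over \<open>R\<close>, matter. Argument positions are counted
  from \<open>0\<close>, and \<open>xs[i := a]\<close> is the tuple \<open>xs\<close> with its slot \<open>i\<close> replaced by \<open>a\<close>.
\<close>

definition hypergroup_zero :: "nat \<Rightarrow> 'a set \<Rightarrow> ('a list \<Rightarrow> 'a set) \<Rightarrow> 'a \<Rightarrow> bool" where
  "hypergroup_zero m R f e \<longleftrightarrow> e \<in> R \<and> (\<forall>x\<in>R. f (x # replicate (m - 1) e) = {x})"

definition zero_of :: "nat \<Rightarrow> 'a set \<Rightarrow> ('a list \<Rightarrow> 'a set) \<Rightarrow> 'a" where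
  "zero_of m R f = (THE e. hypergroup_zero m R f e)"

definition hypergroup_inverse ::
    "nat \<Rightarrow> 'a set \<Rightarrow> ('a list \<Rightarrow> 'a set) \<Rightarrow> 'a \<Rightarrow> 'a \<Rightarrow> bool" where
  "hypergroup_inverse m R f x y \<longleftrightarrow>
     y \<in> R \<and> zero_of m R f \<in> f (x # y # replicate (m - 2) (zero_of m R f))"

definition inverse_of :: "nat \<Rightarrow> 'a set \<Rightarrow> ('a list \<Rightarrow> 'a set) \<Rightarrow> 'a \<Rightarrow> 'a" where
  "inverse_of m R f x = (THE y. hypergroup_inverse m R f x y)"

locale canonical_hypergroup =
  fixes m :: nat and R :: "'a set" and f :: "'a list \<Rightarrow> 'a set"
  assumes arity_f: "2 \<le> m"
    and f_nonempty: "xs \<in> nlists m R \<Longrightarrow> f xs \<noteq> {}"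
    and f_closed: "xs \<in> nlists m R \<Longrightarrow> f xs \<subseteq> R"
    and f_assoc: "\<lbrakk>xs \<in> nlists (2 * m - 1) R; i < m; j < m\<rbrakk> \<Longrightarrow>
          (\<Union>y\<in>f (take m (drop i xs)). f (take i xs @ y # drop (m + i) xs))
        = (\<Union>y\<in>f (take m (drop j xs)). f (take j xs @ y # drop (m + j) xs))"
    and f_solvable: "\<lbrakk>as \<in> nlists m R; b \<in> R; i < m\<rbrakk> \<Longrightarrow> \<exists>x\<in>R. b \<in> f (as[i := x])"
    and zero_unique: "\<exists>!e. hypergroup_zero m R f e"
    and inverse_unique: "x \<in> R \<Longrightarrow> \<exists>!y. hypergroup_inverse m R f x y"
    and reversible: "\<lbrakk>xs \<in> nlists m R; x \<in> f xs; i < m\<rbrakk> \<Longrightarrow>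
          xs ! i \<in> f (x # map (inverse_of m R f) (take i xs @ drop (Suc i) xs))"

locale krasner_hyperring = canonical_hypergroup m R f
  for m :: nat and n :: nat and R :: "'a set"
    and f :: "'a list \<Rightarrow> 'a set" and g :: "'a list \<Rightarrow> 'a" +
  assumes arity_g: "2 \<le> n"
    and g_closed: "xs \<in> nlists n R \<Longrightarrow> g xs \<in> R"
    and g_assoc: "\<lbrakk>xs \<in> nlists (2 * n - 1) R; i < n; j < n\<rbrakk> \<Longrightarrow>
          g (take i xs @ g (take n (drop i xs)) # drop (n + i) xs)
        = g (take j xs @ g (take n (drop j xs)) # drop (n + j) xs)"
    and distrib: "\<lbrakk>as \<in> nlists n R; xs \<in> nlists m R; i < n\<rbrakk> \<Longrightarrow>
          (\<lambda>y. g (as[i := y])) ` f xs = f (map (\<lambda>x. g (as[i := x])) xs)"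
    and g_zero: "\<lbrakk>xs \<in> nlists n R; zero_of m R f \<in> set xs\<rbrakk> \<Longrightarrow> g xs = zero_of m R f"

locale comm_krasner_hyperring = krasner_hyperring +
  assumes f_comm: "\<lbrakk>xs \<in> nlists m R; mset ys = mset xs\<rbrakk> \<Longrightarrow> f ys = f xs"
    and g_comm: "\<lbrakk>xs \<in> nlists n R; mset ys = mset xs\<rbrakk> \<Longrightarrow> g ys = g xs"

definition scalar_identity :: "nat \<Rightarrow> 'a set \<Rightarrow> ('a list \<Rightarrow> 'a) \<Rightarrow> 'a \<Rightarrow> bool" where
  "scalar_identity n R g e \<longleftrightarrow> e \<in> R \<and> (\<forall>x\<in>R. g (x # replicate (n - 1) e) = x)"

definition subhypergroup :: "nat \<Rightarrow> 'a set \<Rightarrow> ('a list \<Rightarrow> 'a set) \<Rightarrow> 'a set \<Rightarrow> bool" where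
  "subhypergroup m R f I \<longleftrightarrow>
     I \<subseteq> R \<and> I \<noteq> {} \<and>
     (\<forall>xs\<in>nlists m I. f xs \<subseteq> I) \<and>
     (\<forall>bs\<in>nlists m I. \<forall>b\<in>I. \<forall>i<m. \<exists>x\<in>I. b \<in> f (bs[i := x]))"

definition hyperideal ::
    "nat \<Rightarrow> nat \<Rightarrow> 'a set \<Rightarrow> ('a list \<Rightarrow> 'a set) \<Rightarrow> ('a list \<Rightarrow> 'a) \<Rightarrow> 'a set \<Rightarrow> bool" where
  "hyperideal m n R f g I \<longleftrightarrow>
     subhypergroup m R f I \<and>
     (\<forall>xs\<in>nlists n R. \<forall>i<n. (\<lambda>a. g (xs[i := a])) ` I \<subseteq> I)"

definition proper_hyperideal ::
    "nat \<Rightarrow> nat \<Rightarrow> 'a set \<Rightarrow> ('a list \<Rightarrow> 'a set) \<Rightarrow> ('a list \<Rightarrow> 'a) \<Rightarrow> 'a set \<Rightarrow> bool" where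
  "proper_hyperideal m n R f g I \<longleftrightarrow> hyperideal m n R f g I \<and> I \<noteq> R"

definition maximal_hyperideal ::
    "nat \<Rightarrow> nat \<Rightarrow> 'a set \<Rightarrow> ('a list \<Rightarrow> 'a set) \<Rightarrow> ('a list \<Rightarrow> 'a) \<Rightarrow> 'a set \<Rightarrow> bool" where
  "maximal_hyperideal m n R f g M \<longleftrightarrow>
     proper_hyperideal m n R f g M \<and>
     (\<forall>N. hyperideal m n R f g N \<and> M \<subseteq> N \<longrightarrow> N = M \<or> N = R)"

text \<open>The intersection with \<open>R\<close> only matters when there is no maximal hyperideal.\<close>

definition jacobson_radical ::
    "nat \<Rightarrow> nat \<Rightarrow> 'a set \<Rightarrow> ('a list \<Rightarrow> 'a set) \<Rightarrow> ('a list \<Rightarrow> 'a) \<Rightarrow> 'a set" where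
  "jacobson_radical m n R f g = R \<inter> \<Inter> {M. maximal_hyperideal m n R f g M}"

definition J_hyperideal ::
    "nat \<Rightarrow> nat \<Rightarrow> 'a set \<Rightarrow> ('a list \<Rightarrow> 'a set) \<Rightarrow> ('a list \<Rightarrow> 'a) \<Rightarrow> 'a \<Rightarrow> 'a set \<Rightarrow> bool" where
  "J_hyperideal m n R f g e Q \<longleftrightarrow>
     proper_hyperideal m n R f g Q \<and>
     (\<forall>xs\<in>nlists n R. \<forall>i<n.
        g xs \<in> Q \<and> xs ! i \<notin> jacobson_radical m n R f g \<longrightarrow> g (xs[i := e]) \<in> Q)"

definition residual ::
    "nat \<Rightarrow> 'a set \<Rightarrow> ('a list \<Rightarrow> 'a) \<Rightarrow> 'a \<Rightarrow> 'a set \<Rightarrow> 'a \<Rightarrow> 'a set" where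
  "residual n R g e Q x = {y \<in> R. g (x # y # replicate (n - 2) e) \<in> Q}"

end

theory Submission
  imports Defs
begin

text \<open>
  Both directions rest on exchanging a slot of a product with the scalar identity \<open>e\<close>.
  In one direction, \<open>x = g (x, e, \<dots>, e)\<close> arises from \<open>g (x, y, e, \<dots>, e)\<close> by putting \<open>e\<close> in the
  slot of \<open>y\<close>, so the \<open>J\<close>-condition forces \<open>y\<close> into the Jacobson radical whenever \<open>x\<close> is outside \<open>Q\<close>.
  In the other direction, a product \<open>g xs\<close> splits as \<open>g (z, xs ! i, e, \<dots>, e)\<close> with
  \<open>z = g (xs[i := e])\<close> (lemma \<open>factor_out_argument\<close>). If \<open>g xs \<in> Q\<close>, then \<open>xs ! i\<close> lies in the
  residual of \<open>Q\<close> at \<open>z\<close>, so \<open>z \<notin> Q\<close> would put \<open>xs ! i\<close> into the radical.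
\<close>

text \<open>
  Bracketing \<open>(ys, e, y, e, \<dots>, e)\<close> around the first \<open>n\<close> entries gives the left side and around the
  last \<open>n\<close> entries the right side, because the inner product \<open>g (e, y, e, \<dots>, e)\<close> is \<open>y\<close>.
\<close>
lemma (in comm_krasner_hyperring) factor_out_last:
  assumes e: "scalar_identity n R g e"
    and ys: "ys \<in> nlists (n - 1) R" and y: "y \<in> R"
  shows "g (g (ys @ [e]) # y # replicate (n - 2) e) = g (ys @ [y])"
proof -
  have eR: "e \<in> R" using e by (simp add: scalar_identity_def)
  have len: "length ys = n - 1" and ysR: "set ys \<subseteq> R" using ys unfolding nlists_def by auto
  obtain k where n: "n = Suc (Suc k)"
    using arity_g by (metis add_2_eq_Suc le_Suc_ex)
  let ?w = "e # y # replicate (n - 2) e"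
  have "mset ?w = mset (y # replicate (n - 1) e)"
    by (simp add: n)
  moreover have "y # replicate (n - 1) e \<in> nlists n R"
    using arity_g eR y unfolding nlists_def by auto
  ultimately have "g ?w = g (y # replicate (n - 1) e)" by (rule g_comm[rotated])
  then have w: "g ?w = y" using e y by (simp add: scalar_identity_def)
  have "ys @ ?w \<in> nlists (2 * n - 1) R"
    using arity_g eR y len ysR unfolding nlists_def by auto
  then have "g (g (take n (ys @ ?w)) # drop n (ys @ ?w))
      = g (ys @ [g (take n ?w)])"
    using g_assoc[of "ys @ ?w" 0 "n - 1"] arity_g len by simp
  moreover have "take n (ys @ ?w) = ys @ [e]" "drop n (ys @ ?w) = y # replicate (n - 2) e"
    "take n ?w = ?w"
    using arity_g len by (simp_all add: take_Cons' drop_Cons')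
  ultimately show ?thesis by (simp only: w)
qed

text \<open>By commutativity, slot \<open>i\<close> may be moved to the end, which reduces to \<open>factor_out_last\<close>.\<close>
lemma (in comm_krasner_hyperring) factor_out_argument:
  assumes e: "scalar_identity n R g e"
    and xs: "xs \<in> nlists n R" and i: "i < n"
  shows "g (g (xs[i := e]) # xs ! i # replicate (n - 2) e) = g xs"
proof -
  define ys where "ys = take i xs @ drop (Suc i) xs"
  have eR: "e \<in> R" using e by (simp add: scalar_identity_def)
  have len: "length xs = n" and xsR: "set xs \<subseteq> R" using xs unfolding nlists_def by auto
  have ys: "ys \<in> nlists (n - 1) R"
    using len xsR i set_take_subset[of i xs] set_drop_subset[of "Suc i" xs]
    unfolding ys_def nlists_def by auto
  have upd: "g (xs[i := a]) = g (ys @ [a])" if "a \<in> R" for a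
  proof (rule g_comm)
    show "ys @ [a] \<in> nlists n R" using ys that i unfolding nlists_def by auto
    show "mset (xs[i := a]) = mset (ys @ [a])"
      using i len by (simp add: ys_def upd_conv_take_nth_drop)
  qed
  have xi: "xs ! i \<in> R" using len xsR i by auto
  show ?thesis
    using factor_out_last[OF e ys xi] upd[OF eR] upd[OF xi] by simp
qed

theorem theorem3p8:
  fixes m n :: nat and R :: "'a set"
    and f :: "'a list \<Rightarrow> 'a set" and g :: "'a list \<Rightarrow> 'a"
    and e :: 'a and Q :: "'a set"
  assumes "comm_krasner_hyperring m n R f g"
    and "scalar_identity n R g e"
    and "proper_hyperideal m n R f g Q"
  shows "J_hyperideal m n R f g e Q \<longleftrightarrow>
    (\<forall>x\<in>R. x \<notin> Q \<longrightarrow> residual n R g e Q x \<subseteq> jacobson_radical m n R f g)"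
proof -
  interpret comm_krasner_hyperring m n R f g by (rule assms(1))
  have eR: "e \<in> R" and unit: "\<And>x. x \<in> R \<Longrightarrow> g (x # replicate (n - 1) e) = x"
    using assms(2) by (auto simp: scalar_identity_def)
  obtain k where n: "n = Suc (Suc k)"
    using arity_g by (metis add_2_eq_Suc le_Suc_ex)
  let ?J = "jacobson_radical m n R f g"
  show ?thesis
  proof (intro iffI ballI impI subsetI)
    fix x y
    assume JQ: "J_hyperideal m n R f g e Q" and x: "x \<in> R" "x \<notin> Q"
      and "y \<in> residual n R g e Q x"
    then have y: "y \<in> R" and xy: "g (x # y # replicate (n - 2) e) \<in> Q"
      by (auto simp: residual_def)
    let ?xs = "x # y # replicate (n - 2) e"
    have xs: "?xs \<in> nlists n R" using arity_g x y eR unfolding nlists_def by auto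
    have "?xs[1 := e] = x # replicate (n - 1) e"
      by (simp add: n)
    then have "g (?xs[1 := e]) \<notin> Q" using unit x by simp
    moreover have "1 < n" using arity_g by simp
    ultimately have "?xs ! 1 \<in> ?J"
      using JQ xs xy unfolding J_hyperideal_def by blast
    then show "y \<in> ?J" by simp
  next
    assume res: "\<forall>x\<in>R. x \<notin> Q \<longrightarrow> residual n R g e Q x \<subseteq> ?J"
    have "g (xs[i := e]) \<in> Q"
      if xs: "xs \<in> nlists n R" and i: "i < n" and "g xs \<in> Q" and notJ: "xs ! i \<notin> ?J" for xs i
    proof (rule ccontr)
      assume "g (xs[i := e]) \<notin> Q"
      moreover have "xs[i := e] \<in> nlists n R"
        using xs eR set_update_subset_insert[of xs i e]
        unfolding nlists_def by auto
      then have "g (xs[i := e]) \<in> R" by (rule g_closed)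
      moreover have "xs ! i \<in> residual n R g e Q (g (xs[i := e]))"
        using factor_out_argument[OF assms(2) xs i] \<open>g xs \<in> Q\<close> xs i
        unfolding residual_def nlists_def by auto
      ultimately show False using res notJ by blast
    qed
    then show "J_hyperideal m n R f g e Q"
      using assms(3) by (auto simp: J_hyperideal_def)
  qed
qed

end
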